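(* Let $Y$ be a convergence-approach space. (i) If $Y$ is $\oplus$-regular, then for every convergence-approach space $X$ and every function $f\in Y^{X}$, $$m_{\oplus}(f)\leq\Big(\bigwedge_{\mathcal{F}\in\mathbb{F}(Y^{X})}\lambda_{[X,Y]}(\mathcal{F})(f)\Big)\oplus\Big(\bigwedge_{\mathcal{F}\in\mathbb{F}(Y^{X})}\lambda_{[X,Y]}(\mathcal{F})(f)\Big).$$ (ii) Conversely, if $Y$ is not $\oplus$-regular, then there are a topological space $X$ (viewed as a convergence-approach space) and a function $f\in Y^{X}$ with $$m_{\oplus}(f)>\bigwedge_{\mathcal{F}\in\mathbb{F}(Y^{X})}\lambda_{[X,Y]}(\mathcal{F})(f).$$
   Context: Filters are proper. $\mathbb{F}X$ is the set of filters on a set $X$, ordered by inclusion ($\mathcal{F}\le\mathcal{G}$ iff $\mathcal{F}\subseteq\mathcal{G}$); $\mathbb{U}X$ is the set of ultrafilters; $\mathcal{F}\wedge\mathcal{G}=\mathcal{F}\cap\mathcal{G}$; for a family $\mathcal{A}$ of subsets of $X$, $\mathcal{A}^{\uparrow}=\{B\subseteq X:\exists A\in\mathcal{A},\ A\subseteq B\}$, and $\{x\}^{\uparrow}$ is the principal ultrafilter at $x$. A filter base is identified with the filter it generates. For $f:X\to Y$, $f[\mathcal{F}]=\{f(F):F\in\mathcal{F}\}^{\uparrow}$. A convergence-approach space (CAP space) is a pair $(X,\lambda_X)$ with $\lambda_X:\mathbb{F}X\to[0,\infty]^{X}$ (ordered pointwise) such that $\lambda_X(\mathcal{F}\wedge\mathcal{G})=\lambda_X(\mathcal{F})\vee\lambda_X(\mathcal{G})$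 for all $\mathcal{F},\mathcal{G}\in\mathbb{F}X$ and $\lambda_X(\{x\}^{\uparrow})(x)=0$ for all $x\in X$. A topological space is viewed as a CAP space via $\lambda_X(\mathcal{F})(x)=0$ if $\mathcal{F}$ converges to $x$ (i.e. $\mathcal F$ contains the neighborhood filter of $x$) and $\infty$ otherwise. $\oplus:[0,\infty]\times[0,\infty]\to[0,\infty]$ is a fixed commutative associative operation such that $0\oplus r=r$ and $r\oplus\bigwedge_{a\in A}a=\bigwedge_{a\in A}(r\oplus a)$ for all $r\in[0,\infty]$, $A\subseteq[0,\infty]$ (where $\bigwedge$ is infimum). For $A\subseteq X$ and $\epsilon\ge0$, $A^{(\epsilon)}=\{x\in X:\exists\,\mathcal{U}\in\mathbb{U}X,\ A\in\mathcal{U},\ \lambda_X(\mathcal{U})(x)\le\epsilon\}$, and $\mathcal{F}^{(\epsilon)}=\{F^{(\epsilon)}:F\in\mathcal{F}\}$. A CAP space $(X,\lambda_X)$ is $\oplus$-regular if $\lambda_X(\mathcal{F}^{(\epsilon)})\le\lambda_X(\mathcal{F})\oplus\epsilon$ for all $\mathcal{F}\in\mathbb{F}X$ and $\epsilon\in[0,\infty]$. For CAP spaces $X,Y$, $f\in Y^{X}$ (the set of all functions $X\to Y$) and $\mathcal{F}\in\mathbb{F}(Y^{X})$, set $$\lambda_{[X,Y]}(\mathcal{F})(f)=\inf\{\alpha\in[0,\infty]:\forall\mathcal{G}\in\mathbb{F}X,\ \lambda_{Y}(\langle\mathcal{G},\mathcal{F}\rangle)\circ f\le\lambda_{X}(\mathcal{G})\vee\alpha\},$$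 where $\langle\mathcal{G},\mathcal{F}\rangle=\{\langle G,F\rangle:G\in\mathcal{G},F\in\mathcal{F}\}^{\uparrow}$ and $\langle G,F\rangle=\{h(x):h\in F,x\in G\}$. The $\oplus$-default of contraction of $f\in Y^{X}$ is $$m_{\oplus}(f)=\inf\{\alpha\in[0,\infty]:\forall\mathcal{G}\in\mathbb{F}X,\ \lambda_{Y}(f[\mathcal{G}])\circ f\le\lambda_{X}(\mathcal{G})\oplus\alpha\}.$$ *)

theory Defs
  imports "HOL-Analysis.Analysis"
begin

text \<open>
  A proper filter on a set \<open>X\<close> of elements of type \<open>'a\<close> is a library filter \<open>F\<close> with
  \<open>F \<noteq> bot\<close> that contains \<open>X\<close>, that is, \<open>F \<le> principal X\<close>. A set \<open>A \<subseteq> X\<close> belongs to \<open>F\<close>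
  when \<open>eventually (\<lambda>x. x \<in> A) F\<close>. The library order on filters is the reverse of inclusion:
  \<open>F \<le> G\<close> says that \<open>F\<close> contains \<open>G\<close>, and the intersection of the filters \<open>F\<close> and \<open>G\<close> is
  \<open>sup F G\<close>. The image of \<open>F\<close> under \<open>f\<close> is \<open>filtermap f F\<close>, and the principal ultrafilter at
  \<open>x\<close> is \<open>principal {x}\<close>.
\<close>

definition filters_on :: "'a set \<Rightarrow> 'a filter set" where
  "filters_on X = {F. F \<noteq> bot \<and> F \<le> principal X}"

definition ultrafilters_on :: "'a set \<Rightarrow> 'a filter set" where
  "ultrafilters_on X = {U \<in> filters_on X. \<forall>F \<in> filters_on X. F \<le> U \<longrightarrow> F = U}"

text \<open>
  The values of \<open>lX\<close> matter only at filters on \<open>X\<close> and points of \<open>X\<close>; elsewhere they are arbitrary.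
\<close>

definition cap_space :: "'a set \<Rightarrow> ('a filter \<Rightarrow> 'a \<Rightarrow> ennreal) \<Rightarrow> bool" where
  "cap_space X lX \<longleftrightarrow>
     (\<forall>F \<in> filters_on X. \<forall>G \<in> filters_on X. \<forall>x \<in> X. lX (sup F G) x = max (lX F x) (lX G x)) \<and>
     (\<forall>x \<in> X. lX (principal {x}) x = 0)"

definition top_cap :: "'a topology \<Rightarrow> 'a filter \<Rightarrow> 'a \<Rightarrow> ennreal" where
  "top_cap T F x = (if F \<le> nhdsin T x then 0 else \<infinity>)"

text \<open>The second condition includes \<open>A = {}\<close>, where \<open>Inf {} = \<infinity>\<close>.\<close>

definition cap_tensor :: "(ennreal \<Rightarrow> ennreal \<Rightarrow> ennreal) \<Rightarrow> bool" where
  "cap_tensor opl \<longleftrightarrow>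
     comm_monoid opl 0 \<and>
     (\<forall>r. \<forall>A :: ennreal set. opl r (Inf A) = Inf (opl r ` A))"

definition enlarge :: "'a set \<Rightarrow> ('a filter \<Rightarrow> 'a \<Rightarrow> ennreal) \<Rightarrow> ennreal \<Rightarrow> 'a set \<Rightarrow> 'a set" where
  "enlarge X lX e A =
     {x \<in> X. \<exists>U \<in> ultrafilters_on X. eventually (\<lambda>a. a \<in> A) U \<and> lX U x \<le> e}"

definition enlarge_filter ::
  "'a set \<Rightarrow> ('a filter \<Rightarrow> 'a \<Rightarrow> ennreal) \<Rightarrow> ennreal \<Rightarrow> 'a filter \<Rightarrow> 'a filter" where
  "enlarge_filter X lX e F =
     (INF A \<in> {A. A \<subseteq> X \<and> eventually (\<lambda>a. a \<in> A) F}. principal (enlarge X lX e A))"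

definition oplus_regular ::
  "(ennreal \<Rightarrow> ennreal \<Rightarrow> ennreal) \<Rightarrow> 'a set \<Rightarrow> ('a filter \<Rightarrow> 'a \<Rightarrow> ennreal) \<Rightarrow> bool" where
  "oplus_regular opl X lX \<longleftrightarrow>
     (\<forall>F \<in> filters_on X. \<forall>e. \<forall>x \<in> X. lX (enlarge_filter X lX e F) x \<le> opl (lX F x) e)"

text \<open>The filter with base the sets \<open>{h x | h x. h \<in> F \<and> x \<in> G}\<close>.\<close>

definition eval_filter :: "'a filter \<Rightarrow> ('a \<Rightarrow> 'b) filter \<Rightarrow> 'b filter" where
  "eval_filter \<G> \<F> = filtermap (\<lambda>(x, h). h x) (\<G> \<times>\<^sub>F \<F>)"

text \<open>The function set from \<open>X\<close> to \<open>Y\<close> is the library's \<open>X \<rightarrow>\<^sub>E Y\<close>.\<close>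

definition hom_limit ::
  "'a set \<Rightarrow> ('a filter \<Rightarrow> 'a \<Rightarrow> ennreal) \<Rightarrow> ('b filter \<Rightarrow> 'b \<Rightarrow> ennreal) \<Rightarrow>
     ('a \<Rightarrow> 'b) filter \<Rightarrow> ('a \<Rightarrow> 'b) \<Rightarrow> ennreal" where
  "hom_limit X lX lY \<F> f =
     Inf {\<alpha>. \<forall>\<G> \<in> filters_on X. \<forall>x \<in> X. lY (eval_filter \<G> \<F>) (f x) \<le> max (lX \<G> x) \<alpha>}"

definition contraction_default ::
  "(ennreal \<Rightarrow> ennreal \<Rightarrow> ennreal) \<Rightarrow> 'a set \<Rightarrow> ('a filter \<Rightarrow> 'a \<Rightarrow> ennreal) \<Rightarrow>
     ('b filter \<Rightarrow> 'b \<Rightarrow> ennreal) \<Rightarrow> ('a \<Rightarrow> 'b) \<Rightarrow> ennreal" where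
  "contraction_default opl X lX lY f =
     Inf {\<alpha>. \<forall>\<G> \<in> filters_on X. \<forall>x \<in> X. lY (filtermap f \<G>) (f x) \<le> opl (lX \<G> x) \<alpha>}"

lemma cap_space_top_cap: "cap_space (topspace T) (top_cap T)"
  by (auto simp: cap_space_def top_cap_def le_filter_def eventually_nhdsin eventually_principal
      eventually_sup)

lemma eventually_eval_filter:
  "eventually P (eval_filter \<G> \<F>) \<longleftrightarrow>
     (\<exists>G F. eventually (\<lambda>x. x \<in> G) \<G> \<and> eventually (\<lambda>h. h \<in> F) \<F> \<and> (\<forall>h \<in> F. \<forall>x \<in> G. P (h x)))"
proof
  assume "eventually P (eval_filter \<G> \<F>)"
  then obtain Pf Pg where "eventually Pf \<G>" "eventually Pg \<F>" "\<And>x h. Pf x \<Longrightarrow> Pg h \<Longrightarrow> P (h x)"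
    by (auto simp: eval_filter_def eventually_filtermap eventually_prod_filter)
  then show "\<exists>G F. eventually (\<lambda>x. x \<in> G) \<G> \<and> eventually (\<lambda>h. h \<in> F) \<F> \<and>
      (\<forall>h \<in> F. \<forall>x \<in> G. P (h x))"
    by (intro exI[of _ "Collect Pf"] exI[of _ "Collect Pg"]) auto
next
  assume "\<exists>G F. eventually (\<lambda>x. x \<in> G) \<G> \<and> eventually (\<lambda>h. h \<in> F) \<F> \<and>
      (\<forall>h \<in> F. \<forall>x \<in> G. P (h x))"
  then obtain G F where "eventually (\<lambda>x. x \<in> G) \<G>" "eventually (\<lambda>h. h \<in> F) \<F>"
      "\<forall>h \<in> F. \<forall>x \<in> G. P (h x)"
    by blast
  then show "eventually P (eval_filter \<G> \<F>)"
    unfolding eval_filter_def eventually_filtermap eventually_prod_filter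
    by (intro exI[of _ "\<lambda>x. x \<in> G"] exI[of _ "\<lambda>h. h \<in> F"]) auto
qed

lemma eventually_enlarge_filter:
  assumes "F \<in> filters_on X"
  shows "eventually P (enlarge_filter X lX e F) \<longleftrightarrow>
     (\<exists>A \<subseteq> X. eventually (\<lambda>a. a \<in> A) F \<and> (\<forall>x \<in> enlarge X lX e A. P x))"
proof -
  let ?B = "{A. A \<subseteq> X \<and> eventually (\<lambda>a. a \<in> A) F}"
  have mono: "enlarge X lX e (A \<inter> B) \<subseteq> enlarge X lX e A \<inter> enlarge X lX e B" for A B
    by (auto simp: enlarge_def elim: eventually_mono)
  have X: "X \<in> ?B"
    using assms by (auto simp: filters_on_def le_principal)
  have dir: "\<exists>C \<in> ?B. principal (enlarge X lX e C) \<le>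
      inf (principal (enlarge X lX e A)) (principal (enlarge X lX e B))"
    if "A \<in> ?B" "B \<in> ?B" for A B
    using that mono[of A B]
    by (intro bexI[of _ "A \<inter> B"]) (auto simp: eventually_conj_iff)
  have "eventually P (enlarge_filter X lX e F) \<longleftrightarrow>
      (\<exists>A \<in> ?B. eventually P (principal (enlarge X lX e A)))"
    unfolding enlarge_filter_def
    by (rule eventually_INF_base) (use X dir in blast)+
  then show ?thesis
    by (auto simp: eventually_principal)
qed

end

theory Submission
  imports Defs
begin

text \<open>
  Write \<open>c\<close> for the infimum of the limits \<open>\<lambda>\<^bsub>[X,Y]\<^esub>(\<F>)(f)\<close>.

  If \<open>Y\<close> is regular and \<open>\<F>\<close> has limit below \<open>\<alpha>\<close> at \<open>f\<close>, testing \<open>\<F>\<close> on the principal ultrafilter at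
  \<open>x\<close> shows that \<open>\<langle>{x}, \<F>\<rangle>\<close> converges to \<open>f x\<close> with defect at most \<open>\<alpha>\<close>. An ultrafilter finer than
  \<open>\<langle>{x}, \<F>\<rangle>\<close> then witnesses that \<open>f x\<close> lies in the \<open>\<alpha>\<close>-enlargement of every set \<open>\<langle>G, F\<rangle>\<close> with
  \<open>x \<in> G\<close> (lemma \<open>image_filter_le_enlarge_eval_filter\<close>). Hence \<open>f[\<G>]\<close> is finer than
  \<open>\<langle>\<G>, \<F>\<rangle>\<^sup>(\<^sup>\<alpha>\<^sup>)\<close>, and regularity bounds its limit by \<open>(\<lambda>(\<G>) \<or> \<alpha>) \<oplus> \<alpha> \<le> \<lambda>(\<G>) \<oplus> (\<alpha> \<oplus> \<alpha>)\<close>. Let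
  \<open>\<alpha>\<close> decrease to \<open>c\<close> and use that \<open>\<oplus>\<close> preserves infima.

  If regularity fails for \<open>F\<close>, \<open>e\<close> and \<open>z\<close>, let \<open>X\<close> consist of a point \<open>None\<close> and of isolated points
  \<open>Some (A, y)\<close>, one for each \<open>A \<in> F\<close> and \<open>y \<in> A\<^sup>(\<^sup>e\<^sup>)\<close>; a basic neighbourhood of \<open>None\<close> consists of
  \<open>None\<close> and all the pairs whose first component is a subset of a fixed member of \<open>F\<close>. The map \<open>f\<close>
  sends \<open>(A, y)\<close> to \<open>y\<close> and \<open>None\<close> to \<open>z\<close>, so it carries the neighbourhoods of \<open>None\<close> to a filter
  coarser than \<open>F\<^sup>(\<^sup>e\<^sup>)\<close>, and its default of contraction is at least \<open>\<lambda>(F\<^sup>(\<^sup>e\<^sup>))(z)\<close> (lemma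
  \<open>limit_enlarge_filter_le_contraction_default\<close>). On the other hand each \<open>(A, y)\<close> comes with an
  ultrafilter that contains \<open>A\<close> and converges to \<open>y\<close> up to \<open>e\<close>. The box product of these ultrafilters,
  with the principal one at \<open>z\<close> for the point \<open>None\<close>, is a filter of functions that converges to \<open>f\<close>
  up to \<open>\<lambda>(F)(z) \<or> e\<close> (lemma \<open>ex_hom_limit_test_map_le\<close>): at the isolated points by choice of the
  ultrafilters, and at \<open>None\<close> because the functions that map each \<open>(A, y)\<close> into \<open>A\<close> form a member of
  it. Since \<open>\<lambda>(F)(z) \<or> e \<le> \<lambda>(F)(z) \<oplus> e < \<lambda>(F\<^sup>(\<^sup>e\<^sup>))(z)\<close>, the inequality is strict.
\<close>

section \<open>Filters and ultrafilters on a set\<close>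

lemma filters_on_eventually_mem:
  assumes "F \<in> filters_on X"
  shows "eventually (\<lambda>x. x \<in> X) F"
  using assms by (simp add: filters_on_def le_principal)

lemma principal_in_filters_on: "x \<in> X \<Longrightarrow> principal {x} \<in> filters_on X"
  by (auto simp: filters_on_def principal_eq_bot_iff)

lemma filtermap_in_filters_on:
  assumes "G \<in> filters_on X" "f \<in> X \<rightarrow> Y"
  shows "filtermap f G \<in> filters_on Y"
  using assms
  by (auto simp: filters_on_def filtermap_bot_iff le_principal eventually_filtermap
      elim: eventually_mono)

lemma eval_filter_in_filters_on:
  assumes "G \<in> filters_on X" "\<F> \<in> filters_on (X \<rightarrow>\<^sub>E Y)"
  shows "eval_filter G \<F> \<in> filters_on Y"
proof -
  have "eventually (\<lambda>y. y \<in> Y) (eval_filter G \<F>)"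
    unfolding eventually_eval_filter
    using filters_on_eventually_mem[OF assms(1)] filters_on_eventually_mem[OF assms(2)]
    by (intro exI[of _ X] exI[of _ "X \<rightarrow>\<^sub>E Y"]) auto
  then show ?thesis
    using assms
    by (auto simp: filters_on_def eval_filter_def filtermap_bot_iff prod_filter_eq_bot le_principal)
qed

text \<open>
  Zorn's lemma for the reversed order: the infimum of a nonempty chain of proper filters is proper,
  because each of its members already belongs to a filter of the chain.
\<close>

lemma ultrafilter_below:
  assumes "F \<in> filters_on X"
  obtains U where "U \<in> ultrafilters_on X" "U \<le> F"
proof -
  let ?P = "{G. G \<noteq> bot \<and> G \<le> F}"
  have "\<exists>M \<in> ?P. \<forall>G \<in> ?P. G \<le> M \<longrightarrow> G = M"
  proof (rule predicate_Zorn)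
    show "partial_order_on ?P (relation_of (\<ge>) ?P)"
      by (rule partial_order_on_relation_ofI) auto
  next
    fix C assume "C \<in> Chains (relation_of (\<ge>) ?P)"
    then have C: "C \<subseteq> ?P" "\<And>G H. G \<in> C \<Longrightarrow> H \<in> C \<Longrightarrow> G \<le> H \<or> H \<le> G"
      by (auto simp: Chains_def relation_of_def)
    show "\<exists>u \<in> ?P. \<forall>G \<in> C. u \<le> G"
    proof (cases "C = {}")
      case True
      then show ?thesis
        using assms by (auto simp: filters_on_def)
    next
      case False
      have "eventually P (Inf C) \<longleftrightarrow> (\<exists>G \<in> C. eventually P G)" for P
        by (rule eventually_Inf_base) (use False C(2) in \<open>metis inf.order_iff le_inf_iff order_refl\<close>)+
      then have "Inf C \<noteq> bot"
        using C(1) by (auto simp: trivial_limit_def)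
      moreover have "Inf C \<le> F"
        using False C(1) by (auto intro: Inf_lower2)
      ultimately show ?thesis
        by (auto intro: Inf_lower)
    qed
  qed
  then obtain M where M: "M \<noteq> bot" "M \<le> F" "\<And>G. G \<noteq> bot \<Longrightarrow> G \<le> F \<Longrightarrow> G \<le> M \<Longrightarrow> G = M"
    by blast
  show thesis
  proof
    show "M \<le> F" by (fact M(2))
    show "M \<in> ultrafilters_on X"
      using M assms by (auto simp: ultrafilters_on_def filters_on_def)
  qed
qed

section \<open>Convergence-approach spaces and the operation on distances\<close>

lemma cap_space_mono:
  assumes "cap_space X lX" "F \<in> filters_on X" "G \<in> filters_on X" "F \<le> G" "x \<in> X"
  shows "lX F x \<le> lX G x"
proof -
  have "lX (sup F G) x = max (lX F x) (lX G x)"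
    using assms unfolding cap_space_def by blast
  then show ?thesis
    using assms(4) by (simp add: sup.absorb2 max_def split: if_splits)
qed

lemma cap_space_sup_point:
  assumes "cap_space X lX" "F \<in> filters_on X" "x \<in> X"
  shows "lX (sup F (principal {x})) x = lX F x"
  using assms principal_in_filters_on[OF assms(3)] unfolding cap_space_def by auto

lemma subset_enlarge:
  assumes "cap_space X lX"
  shows "A \<inter> X \<subseteq> enlarge X lX e A"
proof
  fix x assume x: "x \<in> A \<inter> X"
  have "G = principal {x}" if "G \<noteq> bot" and le: "G \<le> principal {x}" for G
  proof (rule antisym[OF le], rule filter_leI)
    fix P assume "eventually P G"
    moreover have "eventually (\<lambda>y. y = x) G"
      using le by (simp add: le_principal)
    ultimately have "eventually (\<lambda>y. P x) G"
      by eventually_elim simp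
    then show "eventually P (principal {x})"
      using that(1) by (simp add: eventually_const_iff eventually_principal)
  qed
  then have "principal {x} \<in> ultrafilters_on X"
    using x principal_in_filters_on[of x X] by (simp add: ultrafilters_on_def filters_on_def)
  moreover have "lX (principal {x}) x \<le> e"
    using x assms by (simp add: cap_space_def)
  moreover have "eventually (\<lambda>a. a \<in> A) (principal {x})"
    using x by (simp add: eventually_principal)
  ultimately show "x \<in> enlarge X lX e A"
    using x unfolding enlarge_def by blast
qed

lemma enlarge_filter_in_filters_on:
  assumes "cap_space X lX" "F \<in> filters_on X"
  shows "enlarge_filter X lX e F \<in> filters_on X"
proof -
  have "A \<noteq> {}" if "eventually (\<lambda>a. a \<in> A) F" for A
    using that assms(2) by (auto simp: filters_on_def)
  then have "enlarge X lX e A \<noteq> {}" if "A \<subseteq> X" "eventually (\<lambda>a. a \<in> A) F" for A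
    using that subset_enlarge[OF assms(1), of A e] by blast
  then have "enlarge_filter X lX e F \<noteq> bot"
    unfolding trivial_limit_def eventually_enlarge_filter[OF assms(2)] by blast
  moreover have "eventually (\<lambda>x. x \<in> X) (enlarge_filter X lX e F)"
    unfolding eventually_enlarge_filter[OF assms(2)]
    using filters_on_eventually_mem[OF assms(2)] by (auto simp: enlarge_def)
  ultimately show ?thesis
    by (simp add: filters_on_def le_principal)
qed

lemma cap_tensor_comm_monoid: "cap_tensor opl \<Longrightarrow> comm_monoid opl 0"
  by (simp add: cap_tensor_def)

text \<open>Preservation of the infimum of a pair already makes the operation monotone.\<close>

lemma cap_tensor_mono:
  assumes "cap_tensor opl" "a \<le> a'" "b \<le> b'"
  shows "opl a b \<le> opl a' b'"
proof -
  interpret comm_monoid opl 0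
    by (rule cap_tensor_comm_monoid) fact
  have right: "opl r s \<le> opl r t" if "s \<le> t" for r s t
  proof -
    have "opl r (Inf {s, t}) = Inf (opl r ` {s, t})"
      using assms(1) unfolding cap_tensor_def by blast
    then have "opl r s = inf (opl r s) (opl r t)"
      using that by (simp add: inf.absorb1)
    then show ?thesis
      by (metis inf.cobounded2)
  qed
  show ?thesis
    using right[OF assms(3), of a] right[OF assms(2), of b'] by (simp add: commute)
qed

lemma cap_tensor_max_le:
  assumes "cap_tensor opl"
  shows "max a b \<le> opl a b"
proof -
  interpret comm_monoid opl 0
    by (rule cap_tensor_comm_monoid) fact
  show ?thesis
    using cap_tensor_mono[OF assms order_refl[of a], of 0 b]
      cap_tensor_mono[OF assms _ order_refl[of b], of 0 a]
    by simp
qed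

text \<open>
  The infimum over the diagonal suffices, since \<open>opl a b\<close> lies above \<open>opl d d\<close> for
  \<open>d = min a b\<close>. For \<open>c = \<infinity>\<close> no \<open>a\<close> is available, but \<open>opl c c\<close> is infinite, as the image of the
  empty infimum.
\<close>

lemma cap_tensor_self_greatest:
  assumes opl: "cap_tensor opl" and le: "\<And>a. c < a \<Longrightarrow> m \<le> opl a a"
  shows "m \<le> opl c c"
proof -
  interpret comm_monoid opl 0
    by (rule cap_tensor_comm_monoid) fact
  have Inf_gt: "Inf {c<..} = c"
  proof (rule antisym)
    show "Inf {c<..} \<le> c"
    proof (rule dense_ge)
      fix x assume "c < x"
      then show "Inf {c<..} \<le> x" by (auto intro: Inf_lower)
    qed
    show "c \<le> Inf {c<..}"
      by (rule Inf_greatest) auto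
  qed
  have inf: "opl r c = Inf (opl r ` {c<..})" for r
    using opl Inf_gt unfolding cap_tensor_def by metis
  have "m \<le> opl a b" if "c < a" "c < b" for a b
  proof -
    have "m \<le> opl (min a b) (min a b)"
      using that by (intro le) auto
    also have "\<dots> \<le> opl a b"
      by (intro cap_tensor_mono[OF opl]) auto
    finally show ?thesis .
  qed
  then have "m \<le> opl a c" if "c < a" for a
    using that by (subst inf) (auto intro!: INF_greatest)
  then have "m \<le> opl c a" if "c < a" for a
    using that by (simp add: commute)
  then show ?thesis
    by (subst inf) (auto intro!: INF_greatest)
qed

section \<open>The default of contraction over a regular space\<close>

text \<open>
  The bound at the filter \<open>principal {x}\<close> supplies the ultrafilters that the enlargement asks for.
\<close>

lemma image_filter_le_enlarge_eval_filter:
  assumes Y: "cap_space Y lY" and f: "f \<in> X \<rightarrow> Y"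
    and G: "G \<in> filters_on X" and \<F>: "\<F> \<in> filters_on (X \<rightarrow>\<^sub>E Y)"
    and point: "\<And>x. x \<in> X \<Longrightarrow> lY (eval_filter (principal {x}) \<F>) (f x) \<le> \<alpha>"
  shows "filtermap f G \<le> enlarge_filter Y lY \<alpha> (eval_filter G \<F>)"
proof (rule filter_leI)
  fix P assume "eventually P (enlarge_filter Y lY \<alpha> (eval_filter G \<F>))"
  then obtain A where A: "eventually (\<lambda>a. a \<in> A) (eval_filter G \<F>)"
      and P: "\<And>y. y \<in> enlarge Y lY \<alpha> A \<Longrightarrow> P y"
    by (auto simp: eventually_enlarge_filter[OF eval_filter_in_filters_on[OF G \<F>]])
  from A obtain S H where S: "eventually (\<lambda>x. x \<in> S) G" and H: "eventually (\<lambda>h. h \<in> H) \<F>"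
      and SH: "\<And>h x. h \<in> H \<Longrightarrow> x \<in> S \<Longrightarrow> h x \<in> A"
    unfolding eventually_eval_filter by blast
  have "P (f x)" if "x \<in> S" "x \<in> X" for x
  proof -
    let ?E = "eval_filter (principal {x}) \<F>"
    have E: "?E \<in> filters_on Y"
      by (rule eval_filter_in_filters_on[OF principal_in_filters_on \<F>]) fact
    obtain U where U: "U \<in> ultrafilters_on Y" "U \<le> ?E"
      using ultrafilter_below[OF E] .
    have "eventually (\<lambda>a. a \<in> A) ?E"
      unfolding eventually_eval_filter using H SH that(1)
      by (intro exI[of _ "{x}"] exI[of _ H]) (auto simp: eventually_principal)
    then have "eventually (\<lambda>a. a \<in> A) U"
      using U(2) by (rule filter_leD[rotated])
    moreover have "lY U (f x) \<le> \<alpha>"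
      using cap_space_mono[OF Y _ E U(2), of "f x"] U(1) point[OF that(2)] f that(2)
      by (force simp: ultrafilters_on_def)
    ultimately have "f x \<in> enlarge Y lY \<alpha> A"
      using U(1) f that(2) by (auto simp: enlarge_def)
    then show ?thesis by (rule P)
  qed
  with S filters_on_eventually_mem[OF G] have "eventually (\<lambda>x. P (f x)) G"
    by (auto elim: eventually_elim2)
  then show "eventually P (filtermap f G)"
    by (simp add: eventually_filtermap)
qed

lemma contraction_default_le_of_hom_limit_less:
  assumes opl: "cap_tensor opl" and reg: "oplus_regular opl Y lY"
    and X: "cap_space X lX" and Y: "cap_space Y lY" and f: "f \<in> X \<rightarrow> Y"
    and \<F>: "\<F> \<in> filters_on (X \<rightarrow>\<^sub>E Y)" and less: "hom_limit X lX lY \<F> f < \<alpha>"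
  shows "contraction_default opl X lX lY f \<le> opl \<alpha> \<alpha>"
proof -
  interpret comm_monoid opl 0
    by (rule cap_tensor_comm_monoid) fact
  obtain \<beta> where "\<beta> < \<alpha>"
      and \<beta>: "\<And>G x. G \<in> filters_on X \<Longrightarrow> x \<in> X \<Longrightarrow> lY (eval_filter G \<F>) (f x) \<le> max (lX G x) \<beta>"
    using less unfolding hom_limit_def Inf_less_iff by blast
  then have bound: "lY (eval_filter G \<F>) (f x) \<le> max (lX G x) \<alpha>"
    if "G \<in> filters_on X" "x \<in> X" for G x
    using that by (meson max.mono order_refl less_imp_le order_trans)
  have "lY (eval_filter (principal {x}) \<F>) (f x) \<le> \<alpha>" if "x \<in> X" for x
    using bound[OF principal_in_filters_on[OF that] that] X that by (simp add: cap_space_def)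
  note finer = image_filter_le_enlarge_eval_filter[OF Y f _ \<F> this]
  have "lY (filtermap f G) (f x) \<le> opl (lX G x) (opl \<alpha> \<alpha>)"
    if G: "G \<in> filters_on X" and x: "x \<in> X" for G x
  proof -
    let ?E = "eval_filter G \<F>"
    have fx: "f x \<in> Y" using f x by auto
    have E: "?E \<in> filters_on Y"
      by (rule eval_filter_in_filters_on[OF G \<F>])
    have "lY (filtermap f G) (f x) \<le> lY (enlarge_filter Y lY \<alpha> ?E) (f x)"
      by (rule cap_space_mono[OF Y filtermap_in_filters_on[OF G f]
            enlarge_filter_in_filters_on[OF Y E] finer[OF G] fx])
    also have "\<dots> \<le> opl (lY ?E (f x)) \<alpha>"
      using reg E fx unfolding oplus_regular_def by blast
    also have "\<dots> \<le> opl (opl (lX G x) \<alpha>) \<alpha>"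
      using bound[OF G x] cap_tensor_max_le[OF opl]
      by (intro cap_tensor_mono[OF opl]) (auto intro: order_trans)
    finally show ?thesis by (simp add: assoc)
  qed
  then show ?thesis
    unfolding contraction_default_def by (intro Inf_lower) blast
qed

section \<open>Box products of filters\<close>

definition box_filter :: "'a set \<Rightarrow> ('a \<Rightarrow> 'b filter) \<Rightarrow> ('a \<Rightarrow> 'b) filter" where
  "box_filter X U =
     (INF V \<in> {V. \<forall>x \<in> X. eventually (\<lambda>y. y \<in> V x) (U x)}. principal (Pi\<^sub>E X V))"

lemma eventually_box_filter:
  "eventually P (box_filter X U) \<longleftrightarrow>
     (\<exists>V. (\<forall>x \<in> X. eventually (\<lambda>y. y \<in> V x) (U x)) \<and> (\<forall>h \<in> Pi\<^sub>E X V. P h))"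
proof -
  let ?B = "{V. \<forall>x \<in> X. eventually (\<lambda>y. y \<in> V x) (U x)}"
  have "eventually P (box_filter X U) \<longleftrightarrow> (\<exists>V \<in> ?B. eventually P (principal (Pi\<^sub>E X V)))"
    unfolding box_filter_def
  proof (rule eventually_INF_base)
    show "?B \<noteq> {}"
      by (auto intro!: exI[of _ "\<lambda>_. UNIV"])
    fix V W assume "V \<in> ?B" "W \<in> ?B"
    then show "\<exists>Z \<in> ?B. principal (Pi\<^sub>E X Z) \<le> inf (principal (Pi\<^sub>E X V)) (principal (Pi\<^sub>E X W))"
      by (intro bexI[of _ "\<lambda>x. V x \<inter> W x"]) (auto simp: eventually_conj_iff PiE_iff)
  qed
  then show ?thesis
    by (auto simp: eventually_principal)
qed

lemma box_filter_in_filters_on: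
  assumes "\<And>x. x \<in> X \<Longrightarrow> U x \<in> filters_on Y"
  shows "box_filter X U \<in> filters_on (X \<rightarrow>\<^sub>E Y)"
proof -
  have "Pi\<^sub>E X V \<noteq> {}" if "\<forall>x \<in> X. eventually (\<lambda>y. y \<in> V x) (U x)" for V
  proof -
    have "V x \<noteq> {}" if "x \<in> X" for x
      using \<open>\<forall>x \<in> X. _ x\<close> assms[OF that] that by (force simp: filters_on_def)
    then show ?thesis by (simp add: PiE_eq_empty_iff)
  qed
  then have "box_filter X U \<noteq> bot"
    by (auto simp: trivial_limit_def eventually_box_filter)
  moreover have "eventually (\<lambda>h. h \<in> X \<rightarrow>\<^sub>E Y) (box_filter X U)"
    unfolding eventually_box_filter
    by (rule exI[of _ "\<lambda>_. Y"]) (simp add: filters_on_eventually_mem[OF assms])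
  ultimately show ?thesis
    by (simp add: filters_on_def le_principal)
qed

lemma eval_filter_box_filter_le:
  assumes "x \<in> X" "G \<le> principal {x}"
  shows "eval_filter G (box_filter X U) \<le> U x"
proof (rule filter_leI)
  fix P assume P: "eventually P (U x)"
  show "eventually P (eval_filter G (box_filter X U))"
    unfolding eventually_eval_filter
  proof (intro exI conjI)
    show "eventually (\<lambda>y. y \<in> {x}) G"
      using assms(2) by (simp add: le_principal)
    show "eventually (\<lambda>h. h \<in> {h. P (h x)}) (box_filter X U)"
      unfolding eventually_box_filter using P assms(1)
      by (intro exI[of _ "\<lambda>z. if z = x then {y. P y} else UNIV"])
        (auto dest!: PiE_mem[OF _ assms(1)])
  qed auto
qed

section \<open>The test space of a filter\<close>

text \<open>
  The pairs keep the member \<open>A\<close> next to the point \<open>y\<close> of its enlargement, so that a point that lies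
  in several enlargements can be approximated by a different ultrafilter for each of them.
\<close>

definition test_nbhd ::
  "'b set \<Rightarrow> ('b filter \<Rightarrow> 'b \<Rightarrow> ennreal) \<Rightarrow> ennreal \<Rightarrow> 'b filter \<Rightarrow> 'b set \<Rightarrow>
     ('b set \<times> 'b) option set" where
  "test_nbhd Y lY e F A = insert None (Some ` {(B, y).
     B \<subseteq> A \<and> B \<subseteq> Y \<and> eventually (\<lambda>b. b \<in> B) F \<and> y \<in> enlarge Y lY e B})"

definition test_open ::
  "'b set \<Rightarrow> ('b filter \<Rightarrow> 'b \<Rightarrow> ennreal) \<Rightarrow> ennreal \<Rightarrow> 'b filter \<Rightarrow>
     ('b set \<times> 'b) option set \<Rightarrow> bool" where
  "test_open Y lY e F S \<longleftrightarrow> S \<subseteq> test_nbhd Y lY e F Y \<and>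
     (None \<in> S \<longrightarrow> (\<exists>A. eventually (\<lambda>a. a \<in> A) F \<and> test_nbhd Y lY e F A \<subseteq> S))"

definition test_top ::
  "'b set \<Rightarrow> ('b filter \<Rightarrow> 'b \<Rightarrow> ennreal) \<Rightarrow> ennreal \<Rightarrow> 'b filter \<Rightarrow>
     ('b set \<times> 'b) option topology" where
  "test_top Y lY e F = topology (test_open Y lY e F)"

lemma test_nbhd_subset: "test_nbhd Y lY e F A \<subseteq> test_nbhd Y lY e F Y"
  by (auto simp: test_nbhd_def)

lemma openin_test_top: "openin (test_top Y lY e F) = test_open Y lY e F"
proof -
  have "istopology (test_open Y lY e F)"
    unfolding istopology_def
  proof (intro conjI allI impI)
    fix S T assume S: "test_open Y lY e F S" and T: "test_open Y lY e F T"
    show "test_open Y lY e F (S \<inter> T)"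
      unfolding test_open_def
    proof (intro conjI impI)
      assume "None \<in> S \<inter> T"
      then obtain A B where A: "eventually (\<lambda>a. a \<in> A) F" "test_nbhd Y lY e F A \<subseteq> S"
          and B: "eventually (\<lambda>a. a \<in> B) F" "test_nbhd Y lY e F B \<subseteq> T"
        using S T by (auto simp: test_open_def)
      have "test_nbhd Y lY e F (A \<inter> B) \<subseteq> test_nbhd Y lY e F A \<inter> test_nbhd Y lY e F B"
        by (auto simp: test_nbhd_def)
      then show "\<exists>C. eventually (\<lambda>a. a \<in> C) F \<and> test_nbhd Y lY e F C \<subseteq> S \<inter> T"
        using A B by (intro exI[of _ "A \<inter> B"]) (auto simp: eventually_conj_iff)
    qed (use S in \<open>auto simp: test_open_def\<close>)
  next
    fix \<K> assume K: "\<forall>K \<in> \<K>. test_open Y lY e F K"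
    show "test_open Y lY e F (\<Union>\<K>)"
      unfolding test_open_def
    proof (intro conjI impI)
      show "\<Union>\<K> \<subseteq> test_nbhd Y lY e F Y"
        using K by (auto simp: test_open_def)
      assume "None \<in> \<Union>\<K>"
      then obtain K where "K \<in> \<K>" "None \<in> K" by blast
      then show "\<exists>A. eventually (\<lambda>a. a \<in> A) F \<and> test_nbhd Y lY e F A \<subseteq> \<Union>\<K>"
        using K unfolding test_open_def by (meson Union_upper order_trans)
    qed
  qed
  then show ?thesis
    by (simp add: test_top_def topology_inverse')
qed

lemma topspace_test_top:
  assumes "F \<in> filters_on Y"
  shows "topspace (test_top Y lY e F) = test_nbhd Y lY e F Y"
proof -
  have "openin (test_top Y lY e F) (test_nbhd Y lY e F Y)"
    using filters_on_eventually_mem[OF assms] by (auto simp: openin_test_top test_open_def)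
  moreover have "topspace (test_top Y lY e F) \<subseteq> test_nbhd Y lY e F Y"
    using openin_topspace[of "test_top Y lY e F"] by (simp only: openin_test_top test_open_def)
  ultimately show ?thesis
    by (simp add: openin_subset subset_antisym)
qed

lemma eventually_nhdsin_test_top_None:
  assumes "F \<in> filters_on Y"
  shows "eventually P (nhdsin (test_top Y lY e F) None) \<longleftrightarrow>
     (\<exists>A. eventually (\<lambda>a. a \<in> A) F \<and> (\<forall>x \<in> test_nbhd Y lY e F A. P x))"
proof -
  have None: "None \<in> test_nbhd Y lY e F A" for A
    by (simp add: test_nbhd_def)
  have "eventually P (nhdsin (test_top Y lY e F) None) \<longleftrightarrow>
      (\<exists>S. test_open Y lY e F S \<and> None \<in> S \<and> (\<forall>x \<in> S. P x))"
    using None by (simp add: eventually_nhdsin topspace_test_top[OF assms] openin_test_top)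
  also have "\<dots> \<longleftrightarrow> (\<exists>A. eventually (\<lambda>a. a \<in> A) F \<and> (\<forall>x \<in> test_nbhd Y lY e F A. P x))"
  proof
    assume "\<exists>A. eventually (\<lambda>a. a \<in> A) F \<and> (\<forall>x \<in> test_nbhd Y lY e F A. P x)"
    then obtain A where A: "eventually (\<lambda>a. a \<in> A) F" "\<forall>x \<in> test_nbhd Y lY e F A. P x"
      by blast
    then have "test_open Y lY e F (test_nbhd Y lY e F A)"
      using test_nbhd_subset[of Y lY e F A] by (auto simp: test_open_def)
    with A(2) None show "\<exists>S. test_open Y lY e F S \<and> None \<in> S \<and> (\<forall>x \<in> S. P x)" by blast
  qed (auto simp: test_open_def subset_iff)
  finally show ?thesis .
qed

lemma nhdsin_test_top_Some:
  assumes "F \<in> filters_on Y" "Some p \<in> test_nbhd Y lY e F Y"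
  shows "nhdsin (test_top Y lY e F) (Some p) \<le> principal {Some p}"
proof -
  have "openin (test_top Y lY e F) {Some p}"
    using assms(2) by (simp add: openin_test_top test_open_def)
  then show ?thesis
    by (auto simp: le_principal eventually_nhdsin)
qed

definition test_map ::
  "'b set \<Rightarrow> ('b filter \<Rightarrow> 'b \<Rightarrow> ennreal) \<Rightarrow> ennreal \<Rightarrow> 'b filter \<Rightarrow> 'b \<Rightarrow>
     ('b set \<times> 'b) option \<Rightarrow> 'b" where
  "test_map Y lY e F z =
     restrict (\<lambda>p. case p of None \<Rightarrow> z | Some (A, y) \<Rightarrow> y) (test_nbhd Y lY e F Y)"

lemma test_map_in_PiE:
  assumes "F \<in> filters_on Y" "z \<in> Y"
  shows "test_map Y lY e F z \<in> topspace (test_top Y lY e F) \<rightarrow>\<^sub>E Y"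
  using assms
  by (auto simp: topspace_test_top test_map_def test_nbhd_def enlarge_def split: option.splits)

lemma enlarge_filter_le_filtermap_test_map:
  assumes F: "F \<in> filters_on Y"
  shows "enlarge_filter Y lY e F \<le>
     filtermap (test_map Y lY e F z) (nhdsin (test_top Y lY e F) None)"
proof (rule filter_leI)
  fix P assume "eventually P (filtermap (test_map Y lY e F z) (nhdsin (test_top Y lY e F) None))"
  then obtain A where A: "eventually (\<lambda>a. a \<in> A) F"
      and P: "\<And>x. x \<in> test_nbhd Y lY e F A \<Longrightarrow> P (test_map Y lY e F z x)"
    unfolding eventually_filtermap eventually_nhdsin_test_top_None[OF F] by blast
  have AY: "eventually (\<lambda>a. a \<in> A \<inter> Y) F"
    using A filters_on_eventually_mem[OF F] by eventually_elim auto
  have "P y" if "y \<in> enlarge Y lY e (A \<inter> Y)" for y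
  proof -
    have "Some (A \<inter> Y, y) \<in> test_nbhd Y lY e F A"
      using that AY by (simp add: test_nbhd_def)
    with P[OF this] test_nbhd_subset[of Y lY e F A] show ?thesis
      by (simp add: test_map_def subsetD)
  qed
  with AY show "eventually P (enlarge_filter Y lY e F)"
    unfolding eventually_enlarge_filter[OF F] by blast
qed

text \<open>
  The neighbourhood filter of \<open>None\<close> has limit \<open>0\<close> there, so the contraction condition at this filter
  bounds the limit of its image by the default alone.
\<close>

lemma limit_enlarge_filter_le_contraction_default:
  fixes e :: ennreal
  assumes opl: "cap_tensor opl" and Y: "cap_space Y lY" and F: "F \<in> filters_on Y" and z: "z \<in> Y"
  defines "T \<equiv> test_top Y lY e F"
  shows "lY (enlarge_filter Y lY e F) z \<le>
     contraction_default opl (topspace T) (top_cap T) lY (test_map Y lY e F z)"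
  unfolding contraction_default_def
proof (rule Inf_greatest, clarify)
  interpret comm_monoid opl 0
    by (rule cap_tensor_comm_monoid) fact
  let ?f = "test_map Y lY e F z"
  let ?N = "nhdsin T None"
  fix \<alpha>
  assume \<alpha>: "\<forall>G \<in> filters_on (topspace T). \<forall>x \<in> topspace T.
      lY (filtermap ?f G) (?f x) \<le> opl (top_cap T G x) \<alpha>"
  have None: "None \<in> topspace T"
    by (simp add: T_def topspace_test_top[OF F] test_nbhd_def)
  have f: "?f \<in> topspace T \<rightarrow> Y" and fz: "?f None = z"
    using test_map_in_PiE[OF F z, of lY e]
    by (auto simp: T_def test_map_def test_nbhd_def)
  have "eventually (\<lambda>x. x \<in> topspace T) ?N"
    using None by (auto simp: eventually_nhdsin)
  moreover have "?N \<noteq> bot"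
    using None by (auto simp: trivial_limit_def eventually_nhdsin)
  ultimately have N: "?N \<in> filters_on (topspace T)"
    by (simp add: filters_on_def le_principal)
  have "lY (enlarge_filter Y lY e F) z \<le> lY (filtermap ?f ?N) z"
    using enlarge_filter_le_filtermap_test_map[OF F] z
    by (intro cap_space_mono[OF Y enlarge_filter_in_filters_on[OF Y F]
          filtermap_in_filters_on[OF N f]]) (auto simp: T_def)
  also have "\<dots> \<le> opl (top_cap T ?N None) \<alpha>"
    using \<alpha> N None fz by metis
  also have "\<dots> = \<alpha>"
    by (simp add: top_cap_def)
  finally show "lY (enlarge_filter Y lY e F) z \<le> \<alpha>" .
qed

text \<open>
  The box product has to be taken over all pairs at once: then a single set of functions sends
  every pair \<open>(A, y)\<close> into \<open>A\<close>, hence the basic neighbourhood of \<open>None\<close> that belongs to a member \<open>B\<close>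
  of \<open>F\<close> into \<open>B\<close> together with \<open>z\<close>.
\<close>

lemma ex_hom_limit_test_map_le:
  fixes e :: ennreal
  assumes Y: "cap_space Y lY" and F: "F \<in> filters_on Y" and z: "z \<in> Y"
  defines "T \<equiv> test_top Y lY e F"
  shows "\<exists>\<F> \<in> filters_on (topspace T \<rightarrow>\<^sub>E Y).
     hom_limit (topspace T) (top_cap T) lY \<F> (test_map Y lY e F z) \<le> max (lY F z) e"
proof -
  let ?X = "test_nbhd Y lY e F Y"
  let ?f = "test_map Y lY e F z"
  have topspace: "topspace T = ?X"
    by (simp add: T_def topspace_test_top[OF F])
  have "\<forall>p. Some p \<in> ?X \<longrightarrow> (\<exists>U. U \<in> filters_on Y \<and> eventually (\<lambda>a. a \<in> fst p) U \<and> lY U (snd p) \<le> e)"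
    by (auto simp: test_nbhd_def enlarge_def ultrafilters_on_def)
  then obtain V where V: "\<And>p. Some p \<in> ?X \<Longrightarrow>
      V p \<in> filters_on Y \<and> eventually (\<lambda>a. a \<in> fst p) (V p) \<and> lY (V p) (snd p) \<le> e"
    by metis
  define U where "U = case_option (principal {z}) V"
  have U: "U x \<in> filters_on Y" if "x \<in> ?X" for x
    using that V z by (cases x) (auto simp: U_def principal_in_filters_on)
  let ?\<F> = "box_filter ?X U"
  have \<F>: "?\<F> \<in> filters_on (?X \<rightarrow>\<^sub>E Y)"
    by (rule box_filter_in_filters_on[OF U])
  have bound: "lY (eval_filter G ?\<F>) (?f x) \<le> max (lY F z) e"
    if G: "G \<in> filters_on ?X" "G \<le> nhdsin T x" and x: "x \<in> ?X" for G x
  proof (cases x)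
    case (Some p)
    have "G \<le> principal {x}"
      using G(2) nhdsin_test_top_Some[OF F, of p lY e] x Some by (auto simp: T_def)
    then have "eval_filter G ?\<F> \<le> V p"
      using eval_filter_box_filter_le[OF x, of G U] Some by (simp add: U_def)
    moreover have "?f x = snd p" "snd p \<in> Y"
      using x Some by (auto simp: test_map_def test_nbhd_def enlarge_def)
    ultimately have "lY (eval_filter G ?\<F>) (?f x) \<le> lY (V p) (snd p)"
      using cap_space_mono[OF Y eval_filter_in_filters_on[OF G(1) \<F>]] V[of p] x Some by auto
    also have "\<dots> \<le> e"
      using V x Some by auto
    finally show ?thesis
      by (simp add: le_max_iff_disj)
  next
    case None
    have "eval_filter G ?\<F> \<le> sup F (principal {z})"
    proof (rule filter_leI)
      fix P assume P: "eventually P (sup F (principal {z}))"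
      define A where "A = {a. P a}"
      have A: "eventually (\<lambda>a. a \<in> A) F" and "z \<in> A"
        using P by (auto simp: A_def eventually_sup eventually_principal)
      let ?H = "Pi\<^sub>E ?X (case_option {z} fst)"
      have "eventually (\<lambda>h. h \<in> ?H) ?\<F>"
        unfolding eventually_box_filter using V
        by (intro exI[of _ "case_option {z} fst"])
          (auto simp: U_def eventually_principal split: option.splits)
      moreover have "eventually (\<lambda>x. x \<in> test_nbhd Y lY e F A) (nhdsin T None)"
        unfolding T_def eventually_nhdsin_test_top_None[OF F] using A by blast
      then have "eventually (\<lambda>x. x \<in> test_nbhd Y lY e F A) G"
        using G(2) None by (auto intro: filter_leD)
      moreover have "P (h x)" if h: "h \<in> ?H" and x: "x \<in> test_nbhd Y lY e F A" for h x
      proof -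
        have "x \<in> ?X"
          using x test_nbhd_subset[of Y lY e F A] by blast
        then have "h x \<in> case_option {z} fst x"
          using h by (rule PiE_mem[rotated])
        also have "\<dots> \<subseteq> A"
          using x \<open>z \<in> A\<close> by (auto simp: test_nbhd_def)
        finally show ?thesis by (simp add: A_def)
      qed
      ultimately show "eventually P (eval_filter G ?\<F>)"
        unfolding eventually_eval_filter by blast
    qed
    moreover have "sup F (principal {z}) \<in> filters_on Y"
      using F z by (auto simp: filters_on_def le_principal eventually_principal eventually_sup)
    moreover have "?f x = z"
      using None by (simp add: test_map_def test_nbhd_def)
    ultimately have "lY (eval_filter G ?\<F>) (?f x) \<le> lY (sup F (principal {z})) z"
      using cap_space_mono[OF Y eval_filter_in_filters_on[OF G(1) \<F>]] z by auto
    also have "\<dots> = lY F z"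
      by (rule cap_space_sup_point[OF Y F z])
    finally show ?thesis
      by (simp add: le_max_iff_disj)
  qed
  have "hom_limit (topspace T) (top_cap T) lY ?\<F> ?f \<le> max (lY F z) e"
    unfolding hom_limit_def
    by (rule Inf_lower)
      (use bound in \<open>auto simp: topspace top_cap_def max_def top_unique split: if_splits\<close>)
  with \<F> show ?thesis
    unfolding topspace by blast
qed

section \<open>Regularity and the default of contraction\<close>

theorem theorem1:
  fixes opl :: "ennreal \<Rightarrow> ennreal \<Rightarrow> ennreal"
    and Y :: "'b set" and lY :: "'b filter \<Rightarrow> 'b \<Rightarrow> ennreal"
  assumes "cap_tensor opl" and "cap_space Y lY"
  shows
    "(oplus_regular opl Y lY \<longrightarrow>
        (\<forall>(X :: 'a set) lX f. cap_space X lX \<and> f \<in> X \<rightarrow>\<^sub>E Y \<longrightarrow>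
           contraction_default opl X lX lY f
             \<le> opl (INF \<F> \<in> filters_on (X \<rightarrow>\<^sub>E Y). hom_limit X lX lY \<F> f)
                    (INF \<F> \<in> filters_on (X \<rightarrow>\<^sub>E Y). hom_limit X lX lY \<F> f))) \<and>
     (\<not> oplus_regular opl Y lY \<longrightarrow>
        (\<exists>(T :: ('b set \<times> 'b) option topology) f. f \<in> topspace T \<rightarrow>\<^sub>E Y \<and>
           contraction_default opl (topspace T) (top_cap T) lY f
             > (INF \<F> \<in> filters_on (topspace T \<rightarrow>\<^sub>E Y).
                  hom_limit (topspace T) (top_cap T) lY \<F> f)))"
proof (intro conjI impI allI)
  fix X :: "'a set" and lX f
  assume reg: "oplus_regular opl Y lY" and asm: "cap_space X lX \<and> f \<in> X \<rightarrow>\<^sub>E Y"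
  let ?c = "INF \<F> \<in> filters_on (X \<rightarrow>\<^sub>E Y). hom_limit X lX lY \<F> f"
  have f: "f \<in> X \<rightarrow> Y"
    using asm by auto
  show "contraction_default opl X lX lY f \<le> opl ?c ?c"
  proof (rule cap_tensor_self_greatest[OF assms(1)])
    fix \<alpha> assume "?c < \<alpha>"
    then obtain \<F> where "\<F> \<in> filters_on (X \<rightarrow>\<^sub>E Y)" "hom_limit X lX lY \<F> f < \<alpha>"
      by (auto simp: INF_less_iff)
    then show "contraction_default opl X lX lY f \<le> opl \<alpha> \<alpha>"
      using asm f by (intro contraction_default_le_of_hom_limit_less[OF assms(1) reg _ assms(2)]) auto
  qed
next
  assume "\<not> oplus_regular opl Y lY"
  then obtain F e z where F: "F \<in> filters_on Y" and z: "z \<in> Y"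
      and less: "opl (lY F z) e < lY (enlarge_filter Y lY e F) z"
    unfolding oplus_regular_def by (auto simp: not_le)
  let ?T = "test_top Y lY e F" and ?f = "test_map Y lY e F z"
  obtain \<F> where \<F>: "\<F> \<in> filters_on (topspace ?T \<rightarrow>\<^sub>E Y)"
      "hom_limit (topspace ?T) (top_cap ?T) lY \<F> ?f \<le> max (lY F z) e"
    using ex_hom_limit_test_map_le[OF assms(2) F z] by blast
  have "(INF \<F> \<in> filters_on (topspace ?T \<rightarrow>\<^sub>E Y). hom_limit (topspace ?T) (top_cap ?T) lY \<F> ?f)
      \<le> max (lY F z) e"
    using \<F> by (rule INF_lower2)
  also have "\<dots> \<le> opl (lY F z) e"
    by (rule cap_tensor_max_le[OF assms(1)])
  also note less
  also have "lY (enlarge_filter Y lY e F) z \<le>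
      contraction_default opl (topspace ?T) (top_cap ?T) lY ?f"
    by (rule limit_enlarge_filter_le_contraction_default[OF assms F z])
  finally show "\<exists>(T :: ('b set \<times> 'b) option topology) f. f \<in> topspace T \<rightarrow>\<^sub>E Y \<and>
      contraction_default opl (topspace T) (top_cap T) lY f
        > (INF \<F> \<in> filters_on (topspace T \<rightarrow>\<^sub>E Y). hom_limit (topspace T) (top_cap T) lY \<F> f)"
    using test_map_in_PiE[OF F z] by blast
qed

end
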